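(* For every integer $k \geq 5$, the local search problem TSP/k-Opt has the all-exp property.
   Context: A TSP instance is a pair $(G,w)$ where $G=(V,E)$ is a complete undirected graph and $w:E\to\mathbb{R}_{\ge 0}$ assigns edge weights; a tour is a Hamiltonian cycle of $G$, and the goal is to find a tour of minimum total weight. A swap $(E_1,E_2)$ consists of two edge sets $E_1,E_2\subseteq E$ with $|E_1|=|E_2|$; it is a $k$-swap if $|E_1|\le k$. Performing it on a tour removes $E_1$ and adds $E_2$. A swap is improving for a tour $\tau$ if performing it on $\tau$ yields a tour of strictly smaller total weight. TSP/k-Opt is the local search problem whose feasible solutions are tours, with objective the total weight, and where the neighbors of a tour $\tau$ are the tours obtainable from $\tau$ by a $k$-swap; the standard local search algorithm (the k-Opt algorithm) starts from an initial tour and repeatedly performs an improving $k$-swap, chosen by some pivot rule among all available improving $k$-swaps, until none exists (a local optimum). A local search problem has the all-exp property if there are infinitely many pairs of an instance and an initial solution for which the standard local search algorithm needs a number of iterations exponential in the instance size, for every possible pivot rule. *)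

theory Defs
  imports Complex_Main
begin

section \<open>Local search\<close>

text \<open>Minimisation problems only.  For each instance there are feasible solutions, a cost
  and a set of neighbours of every feasible solution.\<close>

record ('i, 's) local_search_problem =
  ls_instances  :: "'i set"
  ls_size       :: "'i \<Rightarrow> nat"
  ls_solutions  :: "'i \<Rightarrow> 's set"
  ls_cost       :: "'i \<Rightarrow> 's \<Rightarrow> real"
  ls_neighbours :: "'i \<Rightarrow> 's \<Rightarrow> 's set"

definition improving_neighbours :: "('i, 's) local_search_problem \<Rightarrow> 'i \<Rightarrow> 's \<Rightarrow> 's set" where
  "improving_neighbours P I s =
     {s' \<in> ls_neighbours P I s \<inter> ls_solutions P I. ls_cost P I s' < ls_cost P I s}"

definition local_optimum :: "('i, 's) local_search_problem \<Rightarrow> 'i \<Rightarrow> 's \<Rightarrow> bool" where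
  "local_optimum P I s \<longleftrightarrow> s \<in> ls_solutions P I \<and> improving_neighbours P I s = {}"

text \<open>A pivot rule may consult the whole history of the run, a nonempty list whose last
  entry is the current solution.  Its value is constrained only where an improvement exists.\<close>

definition pivot_rule :: "('i, 's) local_search_problem \<Rightarrow> 'i \<Rightarrow> ('s list \<Rightarrow> 's) \<Rightarrow> bool" where
  "pivot_rule P I p \<longleftrightarrow>
     (\<forall>h. h \<noteq> [] \<and> last h \<in> ls_solutions P I \<and> \<not> local_optimum P I (last h)
        \<longrightarrow> p h \<in> improving_neighbours P I (last h))"

text \<open>History of the run after at most \<open>t\<close> iterations; the run stops at a local optimum.\<close>

primrec local_search ::
  "('i, 's) local_search_problem \<Rightarrow> 'i \<Rightarrow> ('s list \<Rightarrow> 's) \<Rightarrow> 's \<Rightarrow> nat \<Rightarrow> 's list" where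
  "local_search P I p s 0 = [s]"
| "local_search P I p s (Suc t) =
     (let h = local_search P I p s t in if local_optimum P I (last h) then h else h @ [p h])"

text \<open>At least \<open>L\<close> iterations are needed iff no solution reached after fewer than \<open>L\<close>
  iterations is a local optimum.\<close>

definition needs_iterations ::
  "('i, 's) local_search_problem \<Rightarrow> 'i \<Rightarrow> ('s list \<Rightarrow> 's) \<Rightarrow> 's \<Rightarrow> real \<Rightarrow> bool" where
  "needs_iterations P I p s L \<longleftrightarrow>
     (\<forall>t. real t < L \<longrightarrow> \<not> local_optimum P I (last (local_search P I p s t)))"

text \<open>Exponential means at least \<open>2 powr (c * size)\<close> for one constant \<open>c > 0\<close> shared by all
  pairs.  Requiring infinitely many sizes, rather than just infinitely many pairs, rules out
  families of rescaled or relabelled copies of a single instance, for which the growth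
  condition would be void.\<close>

definition all_exp_property :: "('i, 's) local_search_problem \<Rightarrow> bool" where
  "all_exp_property P \<longleftrightarrow>
     (\<exists>c>0. \<exists>A \<subseteq> Sigma (ls_instances P) (ls_solutions P).
        infinite (ls_size P ` fst ` A) \<and>
        (\<forall>(I, s) \<in> A. \<forall>p. pivot_rule P I p \<longrightarrow>
           needs_iterations P I p s (2 powr (c * real (ls_size P I)))))"


section \<open>The travelling salesman problem with the k-Opt neighbourhood\<close>

text \<open>The graph is the complete graph on the vertex set; only the weights of its edges matter.\<close>

record tsp_instance =
  verts  :: "nat set"
  weight :: "nat set \<Rightarrow> real"

definition edges :: "tsp_instance \<Rightarrow> nat set set" where
  "edges G = {e. e \<subseteq> verts G \<and> card e = 2}"

definition is_tsp_instance :: "tsp_instance \<Rightarrow> bool" where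
  "is_tsp_instance G \<longleftrightarrow> finite (verts G) \<and> (\<forall>e \<in> edges G. weight G e \<ge> 0)"

definition cycle_edges :: "'a list \<Rightarrow> 'a set set" where
  "cycle_edges vs = {{vs ! i, vs ! (Suc i mod length vs)} | i. i < length vs}"

text \<open>A tour is identified with the edge set of the Hamiltonian cycle.\<close>

definition is_tour :: "tsp_instance \<Rightarrow> nat set set \<Rightarrow> bool" where
  "is_tour G T \<longleftrightarrow>
     (\<exists>vs. length vs \<ge> 3 \<and> distinct vs \<and> set vs = verts G \<and> T = cycle_edges vs)"

definition total_weight :: "tsp_instance \<Rightarrow> nat set set \<Rightarrow> real" where
  "total_weight G T = (\<Sum>e\<in>T. weight G e)"

definition is_k_swap :: "tsp_instance \<Rightarrow> nat \<Rightarrow> nat set set \<Rightarrow> nat set set \<Rightarrow> bool" where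
  "is_k_swap G k E\<^sub>1 E\<^sub>2 \<longleftrightarrow>
     E\<^sub>1 \<subseteq> edges G \<and> E\<^sub>2 \<subseteq> edges G \<and> card E\<^sub>1 = card E\<^sub>2 \<and> card E\<^sub>1 \<le> k"

definition perform_swap :: "'e set \<Rightarrow> 'e set \<Rightarrow> 'e set \<Rightarrow> 'e set" where
  "perform_swap E\<^sub>1 E\<^sub>2 T = (T - E\<^sub>1) \<union> E\<^sub>2"

text \<open>Weights are arbitrary reals, so the size of an instance is its number of vertices.\<close>

definition TSP_k_Opt :: "nat \<Rightarrow> (tsp_instance, nat set set) local_search_problem" where
  "TSP_k_Opt k = \<lparr>
     ls_instances  = {G. is_tsp_instance G},
     ls_size       = (\<lambda>G. card (verts G)),
     ls_solutions  = (\<lambda>G. {T. is_tour G T}),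
     ls_cost       = total_weight,
     ls_neighbours = (\<lambda>G T. {perform_swap E\<^sub>1 E\<^sub>2 T | E\<^sub>1 E\<^sub>2.
                        is_k_swap G k E\<^sub>1 E\<^sub>2 \<and> is_tour G (perform_swap E\<^sub>1 E\<^sub>2 T)})\<rparr>"

end

theory Submission
  imports Defs
begin

text \<open>
  Consider paths through a layered digraph, starting at \<open>s\<^sub>0 = 0\<close> and visiting one vertex
  \<open>s\<^sub>i \<in> \<int>/m\<close> in each of \<open>n\<close> layers, where \<open>m = 2\<^sup>k\<^sup>+\<^sup>2\<close> and an arc requires the digit
  \<open>d\<^sub>i = s\<^sub>i\<^sub>+\<^sub>1 - 2 s\<^sub>i mod m\<close> to be at most \<open>2\<close> and costs \<open>3\<^sup>n\<^sup>-\<^sup>i (2 - d\<^sub>i)\<close>.  Replacing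
  \<open>s\<^sub>i\<^sub>+\<^sub>1\<close> by \<open>s\<^sub>i\<^sub>+\<^sub>1 + 1\<close> when \<open>d\<^sub>i < 2\<close> and \<open>d\<^sub>i\<^sub>+\<^sub>1 = 2\<close> is a carry in a redundant binary
  counter: it raises \<open>d\<^sub>i\<close> by \<open>1\<close>, resets \<open>d\<^sub>i\<^sub>+\<^sub>1\<close> to \<open>0\<close> and lowers the cost.  So in a local
  optimum all digits are \<open>2\<close> and the counter value \<open>\<Sum> 2\<^sup>n\<^sup>-\<^sup>1\<^sup>-\<^sup>i d\<^sub>i\<close> is exponential in \<open>n\<close>.
  On the other hand, changing at most \<open>k\<close> layers in any way changes this value by less than
  \<open>2\<^sup>k\<^sup>+\<^sup>1\<close>, because it is determined modulo \<open>m\<close> at each unchanged layer.  Hence every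
  run from the all-zero path is exponentially long.

  The path is completed to a tour by a lane of nodes \<open>0, 2, \<dots>, 2M\<close> that picks up the unvisited
  layer vertices (the odd nodes) as detours.  Moving the path within one layer then exchanges
  five edges.
\<close>

section \<open>Tours, swaps and iteration counts\<close>

lemma tour_incident_edges:
  assumes "is_tour G T" and "v \<in> verts G"
  obtains a b where "a \<noteq> b" "a \<noteq> v" "b \<noteq> v" "{e \<in> T. v \<in> e} = {{v, a}, {v, b}}"
proof -
  obtain vs where len: "length vs \<ge> 3" and dist: "distinct vs" and set: "set vs = verts G"
    and T: "T = cycle_edges vs"
    using assms(1) unfolding is_tour_def by blast
  define l where "l = length vs"
  obtain i where i: "i < l" "vs ! i = v"
    using assms(2) set unfolding l_def by (metis in_set_conv_nth)
  define p where "p = (if i = 0 then l - 1 else i - 1)"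
  define q where "q = (if Suc i = l then 0 else Suc i)"
  have q: "Suc i mod l = q" "q < l" using i len unfolding q_def l_def by auto
  have p: "p < l" using i len unfolding p_def l_def by auto
  have pred: "Suc j mod l = i \<longleftrightarrow> j = p" if "j < l" for j
    using that i len unfolding p_def l_def[symmetric]
    by (cases "Suc j = l") auto
  have ne: "p \<noteq> q" "p \<noteq> i" "q \<noteq> i" using i len unfolding p_def q_def l_def by (auto split: if_splits)
  have inj: "vs ! x = vs ! y \<longleftrightarrow> x = y" if "x < l" "y < l" for x y
    using that dist unfolding l_def by (simp add: nth_eq_iff_index_eq)
  have "{e \<in> T. v \<in> e} = {{v, vs ! p}, {v, vs ! q}}"
  proof (intro equalityI subsetI)
    fix e assume "e \<in> {e \<in> T. v \<in> e}"
    then obtain j where j: "j < l" "e = {vs ! j, vs ! (Suc j mod l)}" and v: "v \<in> e"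
      unfolding T cycle_edges_def l_def by auto
    have "Suc j mod l < l" using j by auto
    then have "j = i \<or> Suc j mod l = i" using v j i inj by auto
    then show "e \<in> {{v, vs ! p}, {v, vs ! q}}" using j i q pred[OF j(1)] by auto
  next
    fix e assume "e \<in> {{v, vs ! p}, {v, vs ! q}}"
    then consider "e = {vs ! p, vs ! (Suc p mod l)}" | "e = {vs ! i, vs ! (Suc i mod l)}"
      using pred[OF p] i q by (auto simp: insert_commute)
    then have "e \<in> T" unfolding T cycle_edges_def l_def[symmetric] using p i by cases blast+
    then show "e \<in> {e \<in> T. v \<in> e}" using \<open>e \<in> {{v, vs ! p}, {v, vs ! q}}\<close> by auto
  qed
  moreover have "vs ! p \<noteq> vs ! q" "vs ! p \<noteq> v" "vs ! q \<noteq> v" using ne inj i p q by auto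
  ultimately show ?thesis using that by blast
qed

lemma cycle_edges_subset:
  assumes "successively (\<lambda>a b. {a, b} \<in> E) vs" and "{last vs, hd vs} \<in> E"
  shows "cycle_edges vs \<subseteq> E"
proof
  fix e assume "e \<in> cycle_edges vs"
  then obtain i where i: "i < length vs" "e = {vs ! i, vs ! (Suc i mod length vs)}"
    unfolding cycle_edges_def by auto
  show "e \<in> E"
  proof (cases "Suc i = length vs")
    case True
    then have "i = length vs - 1" "vs \<noteq> []" by auto
    then have "vs ! i = last vs" "vs ! 0 = hd vs" by (simp_all add: last_conv_nth hd_conv_nth)
    then show ?thesis using assms(2) i True by simp
  next
    case False
    then show ?thesis using assms(1) i by (auto simp: successively_conv_nth)
  qed
qed

lemma card_tour:
  assumes "is_tour G T"
  shows "finite T" "T \<subseteq> edges G" "card T = card (verts G)"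
proof -
  obtain vs where len: "length vs \<ge> 3" and dist: "distinct vs" and set: "set vs = verts G"
    and T: "T = cycle_edges vs"
    using assms(1) unfolding is_tour_def by blast
  define f where "f i = {vs ! i, vs ! (Suc i mod length vs)}" for i
  have T_image: "T = f ` {..<length vs}" unfolding T cycle_edges_def f_def by auto
  show "finite T" using T_image by simp
  have nth_eq: "vs ! i = vs ! j \<longleftrightarrow> i = j" if "i < length vs" "j < length vs" for i j
    using that dist by (simp add: nth_eq_iff_index_eq)
  have lt: "Suc i mod length vs < length vs" for i using len by (intro mod_less_divisor) auto
  show "T \<subseteq> edges G"
  proof
    fix e assume "e \<in> T"
    then obtain i where i: "i < length vs" "e = f i" using T_image by auto
    have "Suc i mod length vs \<noteq> i" using i len by (cases "Suc i = length vs") auto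
    then have "card e = 2" using i nth_eq lt unfolding f_def by (auto simp: card_2_iff)
    then show "e \<in> edges G" using i lt unfolding edges_def f_def set[symmetric] by auto
  qed
  have "inj_on f {..<length vs}"
  proof (rule inj_onI)
    fix i j assume ij: "i \<in> {..<length vs}" "j \<in> {..<length vs}" "f i = f j"
    \<comment> \<open>Equal edges at different indices would make each index the cyclic successor of
      the other, which is impossible on a cycle of length at least 3.\<close>
    then have "i = j \<or> (i = Suc j mod length vs \<and> Suc i mod length vs = j)"
      unfolding f_def using nth_eq lt by (auto simp: doubleton_eq_iff)
    then show "i = j"
      using ij len by (cases "Suc i = length vs"; cases "Suc j = length vs") auto
  qed
  then show "card T = card (verts G)"
    using T_image dist set by (metis card_image card_lessThan distinct_card)
qed

text \<open>\<open>E1\<close> need not lie in \<open>T\<close> and may overlap \<open>E2\<close>,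
  but every edge that is lost lies in \<open>E1\<close>. Together with
  \<open>TSP_neighbourI\<close>, neighbourhoods are thus described by the number of lost edges
  alone.\<close>

lemma TSP_neighbour_card:
  assumes "finite (verts G)" and "T' \<in> ls_neighbours (TSP_k_Opt k) G T"
  shows "is_tour G T'" "card (T - T') \<le> k"
proof -
  obtain E1 E2 where E: "T' = perform_swap E1 E2 T" "is_k_swap G k E1 E2" "is_tour G T'"
    using assms(2) unfolding TSP_k_Opt_def by auto
  show "is_tour G T'" by fact
  have "finite (edges G)" using assms(1) unfolding edges_def by (auto intro: finite_subset[of _ "Pow (verts G)"])
  then have "finite E1" "card E1 \<le> k" using E finite_subset unfolding is_k_swap_def by auto
  moreover have "T - T' \<subseteq> E1" using E unfolding perform_swap_def by auto
  ultimately show "card (T - T') \<le> k" by (meson card_mono le_trans)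
qed

text \<open>All tours of \<open>G\<close> have the same number of edges, so the lost and the gained
  edges are equally many and form a swap.\<close>

lemma TSP_neighbourI:
  assumes "is_tour G T" "is_tour G T'" "card (T - T') \<le> k"
  shows "T' \<in> ls_neighbours (TSP_k_Opt k) G T"
proof -
  have "card (T - T') = card (T' - T)"
    using card_tour[OF assms(1)] card_tour[OF assms(2)]
    by (metis card_Diff_subset_Int finite_Int inf_commute)
  then have "is_k_swap G k (T - T') (T' - T)"
    using card_tour[OF assms(1)] card_tour[OF assms(2)] assms(3) unfolding is_k_swap_def by auto
  moreover have "T' = perform_swap (T - T') (T' - T) T" unfolding perform_swap_def by auto
  ultimately show ?thesis using assms(2) unfolding TSP_k_Opt_def by force
qed

text \<open>A potential argument: each improving step raises \<open>V\<close> by at most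
  \<open>D\<close>, whichever neighbour the pivot rule picks, so reaching \<open>D * B\<close> from
  0 takes at least \<open>B\<close> steps. The set \<open>S\<close> is an invariant of the run and
  confines all hypotheses to reachable solutions.\<close>

lemma needs_iterations_if_lipschitz:
  fixes V :: "'s \<Rightarrow> int"
  assumes pivot: "pivot_rule P I p"
    and sol: "\<And>s. s \<in> S \<Longrightarrow> s \<in> ls_solutions P I"
    and start: "s0 \<in> S" "V s0 \<le> 0"
    and step: "\<And>s s'. s \<in> S \<Longrightarrow> s' \<in> improving_neighbours P I s \<Longrightarrow> s' \<in> S \<and> V s' \<le> V s + D"
    and opt: "\<And>s. s \<in> S \<Longrightarrow> local_optimum P I s \<Longrightarrow> D * B \<le> V s"
    and "0 < D" "L \<le> real_of_int B"
  shows "needs_iterations P I p s0 L"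
  unfolding needs_iterations_def
proof (intro allI impI notI)
  have inv: "local_search P I p s0 t \<noteq> [] \<and> last (local_search P I p s0 t) \<in> S
    \<and> V (last (local_search P I p s0 t)) \<le> D * int t" for t
  proof (induction t)
    case (Suc t)
    define h where "h = local_search P I p s0 t"
    have IH: "h \<noteq> []" "last h \<in> S" "V (last h) \<le> D * int t" using Suc unfolding h_def by auto
    have D: "D * int (Suc t) = D * int t + D" by (simp add: algebra_simps)
    show ?case
    proof (cases "local_optimum P I (last h)")
      case True
      then show ?thesis using IH D \<open>0 < D\<close> by (simp add: Let_def h_def)
    next
      case False
      then have "p h \<in> improving_neighbours P I (last h)"
        using pivot IH sol unfolding pivot_rule_def by blast
      then have "p h \<in> S" "V (p h) \<le> V (last h) + D" using step IH by auto
      then show ?thesis using IH D False by (simp add: Let_def h_def)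
    qed
  qed (use start in auto)
  fix t assume t: "real t < L" "local_optimum P I (last (local_search P I p s0 t))"
  then have "D * B \<le> D * int t" using opt inv by (meson order_trans)
  then have "B \<le> int t" using \<open>0 < D\<close> by simp
  then show False using t \<open>L \<le> real_of_int B\<close> by linarith
qed


section \<open>Splitting the nodes of a digraph\<close>

text \<open>The residues 0, 1, 2 modulo 3 mark the in-, middle and out-vertex of node
  \<open>v\<close>.\<close>

definition expand :: "nat list \<Rightarrow> nat list" where
  "expand xs = concat (map (\<lambda>v. [3 * v, 3 * v + 1, 3 * v + 2]) xs)"

lemma expand_simps [simp]:
  "expand [] = []"
  "expand (v # xs) = 3 * v # (3 * v + 1) # (3 * v + 2) # expand xs"
  by (simp_all add: expand_def)

lemma set_expand: "set (expand xs) = {y. y div 3 \<in> set xs}"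
proof (induction xs)
  case (Cons v xs)
  have "y div 3 = v \<longleftrightarrow> y = 3 * v \<or> y = 3 * v + 1 \<or> y = 3 * v + 2" for y by presburger
  then show ?case using Cons by auto
qed simp

lemma distinct_expand: "distinct xs \<Longrightarrow> distinct (expand xs)"
proof (induction xs)
  case (Cons v xs)
  have "3 * v div 3 = v" "(3 * v + 1) div 3 = v" "(3 * v + 2) div 3 = v" by presburger+
  then show ?case using Cons by (simp add: set_expand del: add_2_eq_Suc' One_nat_def add_Suc_right)
qed simp

lemma expand_ends:
  assumes "xs \<noteq> []"
  shows "expand xs \<noteq> []" "hd (expand xs) = 3 * hd xs" "last (expand xs) = 3 * last xs + 2"
proof -
  show "expand xs \<noteq> []" "hd (expand xs) = 3 * hd xs" using assms by (cases xs; simp)+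
  show "last (expand xs) = 3 * last xs + 2" using assms
    by (induction xs) (auto split: if_splits simp: expand_def)
qed

definition node_edges :: "nat \<Rightarrow> nat set set" where
  "node_edges N = (\<lambda>v. {3 * v, 3 * v + 1}) ` {..N} \<union> (\<lambda>v. {3 * v + 1, 3 * v + 2}) ` {..N}"

text \<open>Joining an out-vertex to an in-vertex makes the direction of the arc readable from the
  undirected edge.\<close>

definition arc_edge :: "nat \<Rightarrow> nat \<Rightarrow> nat set" where
  "arc_edge u w = {3 * u + 2, 3 * w}"

lemma residues_mod_3_distinct:
  fixes a b :: nat
  shows "Suc (3 * a) \<noteq> 3 * b" "3 * b \<noteq> Suc (3 * a)" "Suc (Suc (3 * a)) \<noteq> 3 * b" "3 * b \<noteq> Suc (Suc (3 * a))"
  by presburger+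

lemma arc_edge_eq_iff: "arc_edge u w = arc_edge u' w' \<longleftrightarrow> u = u' \<and> w = w'"
  unfolding arc_edge_def by (auto simp: doubleton_eq_iff residues_mod_3_distinct)

text \<open>Every node edge contains a middle vertex, and an arc edge contains none.\<close>

lemma arc_edge_notin_node_edges: "arc_edge u w \<notin> node_edges N"
proof -
  have "\<exists>x\<in>e. x mod 3 = 1" if "e \<in> node_edges N" for e
    using that unfolding node_edges_def by auto
  moreover have "x mod 3 \<noteq> 1" if "x \<in> arc_edge u w" for x
  proof -
    have "x = 3 * u + 2 \<or> x = 3 * w" using that unfolding arc_edge_def by auto
    then show ?thesis by presburger
  qed
  ultimately show ?thesis by blast
qed

lemma successively_expand:
  assumes "successively (\<lambda>u w. arc_edge u w \<in> E) xs" "set xs \<subseteq> {..N}" "node_edges N \<subseteq> E"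
  shows "successively (\<lambda>a b. {a, b} \<in> E) (expand xs)"
  using assms(1,2)
proof (induction xs)
  case (Cons v xs)
  have "v \<le> N" using Cons.prems by simp
  then have "{3 * v, 3 * v + 1} \<in> E" "{3 * v + 1, 3 * v + 2} \<in> E"
    using assms(3) unfolding node_edges_def by blast+
  then show ?case using Cons by (cases xs) (auto simp: arc_edge_def)
qed simp

text \<open>Splitting every node of a digraph into a path of an in-, a middle and an out-vertex turns
  Hamiltonian tours into successor functions.\<close>

lemma split_tour_functional:
  assumes tour: "is_tour G T" and verts: "verts G = {..<3 * N + 3}"
    and sub: "T \<subseteq> node_edges N \<union> {arc_edge u w | u w. A u w}"
  shows "node_edges N \<subseteq> T"
    and "u \<le> N \<Longrightarrow> \<exists>!w. arc_edge u w \<in> T"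
    and "w \<le> N \<Longrightarrow> \<exists>!u. arc_edge u w \<in> T"
proof -
  have edge_cases: "(\<exists>v. e = {3 * v, 3 * v + 1}) \<or> (\<exists>v. e = {3 * v + 1, 3 * v + 2})
      \<or> (\<exists>u w. e = {3 * u + 2, 3 * w})" if "e \<in> T" for e
    using subsetD[OF sub that] unfolding node_edges_def arc_edge_def by blast
  have mid: "c = 3 * v \<or> c = 3 * v + 2" if "{3 * v + 1, c} \<in> T" for v c
    using edge_cases[OF that] by (auto simp: doubleton_eq_iff residues_mod_3_distinct)
  \<comment> \<open>A middle vertex has only two admissible neighbours and degree two, so both of
    its edges are forced.\<close>
  have mids: "{3 * v, 3 * v + 1} \<in> T \<and> {3 * v + 1, 3 * v + 2} \<in> T" if "v \<le> N" for v
  proof -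
    have "3 * v + 1 \<in> verts G" using that verts by auto
    then obtain a b where ab: "a \<noteq> b" "{e \<in> T. 3 * v + 1 \<in> e} = {{3 * v + 1, a}, {3 * v + 1, b}}"
      by (rule tour_incident_edges[OF tour])
    then have "{3 * v + 1, a} \<in> T" "{3 * v + 1, b} \<in> T" by blast+
    moreover from this mid have "a = 3 * v \<and> b = 3 * v + 2 \<or> a = 3 * v + 2 \<and> b = 3 * v"
      using ab(1) by blast
    ultimately show ?thesis by (auto simp: insert_commute)
  qed
  then show "node_edges N \<subseteq> T" unfolding node_edges_def by auto
  have out: "c = 3 * v + 1 \<or> (\<exists>w. c = 3 * w)" if "{3 * v + 2, c} \<in> T" for v c
    using edge_cases[OF that] by (auto simp: doubleton_eq_iff residues_mod_3_distinct)
  have inn: "c = 3 * v + 1 \<or> (\<exists>u. c = 3 * u + 2)" if "{3 * v, c} \<in> T" for v c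
    using edge_cases[OF that] by (auto simp: doubleton_eq_iff residues_mod_3_distinct)
  show "\<exists>!w. arc_edge u w \<in> T" if "u \<le> N"
  proof -
    have "3 * u + 2 \<in> verts G" using that verts by auto
    then obtain a b where ab: "a \<noteq> b" "{e \<in> T. 3 * u + 2 \<in> e} = {{3 * u + 2, a}, {3 * u + 2, b}}"
      by (rule tour_incident_edges[OF tour])
    then have inT: "{3 * u + 2, a} \<in> T" "{3 * u + 2, b} \<in> T" by blast+
    \<comment> \<open>One of the two tour edges at the out-vertex is its node edge, which leaves
      room for exactly one arc.\<close>
    have "{3 * u + 2, 3 * u + 1} \<in> {{3 * u + 2, a}, {3 * u + 2, b}}"
      using mids[OF that] unfolding ab(2)[symmetric] by (simp add: insert_commute)
    then have "a = 3 * u + 1 \<or> b = 3 * u + 1" by (auto simp: doubleton_eq_iff)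
    then have "\<exists>c. c \<noteq> 3 * u + 1 \<and> {3 * u + 2, c} \<in> T \<and> {a, b} = {c, 3 * u + 1}"
    proof
      assume "a = 3 * u + 1"
      then show ?thesis using ab(1) inT by (intro exI[of _ b]) auto
    next
      assume "b = 3 * u + 1"
      then show ?thesis using ab(1) inT by (intro exI[of _ a]) auto
    qed
    then obtain c where c: "c \<noteq> 3 * u + 1" "{3 * u + 2, c} \<in> T" "{a, b} = {c, 3 * u + 1}" by blast
    then obtain w where w: "c = 3 * w" using out by blast
    have "w' = w" if w': "arc_edge u w' \<in> T" for w'
    proof -
      have "arc_edge u w' \<in> {{3 * u + 2, a}, {3 * u + 2, b}}"
        unfolding ab(2)[symmetric] using w' by (simp add: arc_edge_def)
      then have "3 * w' \<in> {a, b}" unfolding arc_edge_def by (auto simp: doubleton_eq_iff)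
      then have "3 * w' = 3 * w \<or> 3 * w' = 3 * u + 1" unfolding c(3) w by blast
      then show ?thesis by presburger
    qed
    then show ?thesis using c w unfolding arc_edge_def by blast
  qed
  show "\<exists>!u. arc_edge u w \<in> T" if "w \<le> N"
  proof -
    have "3 * w \<in> verts G" using that verts by auto
    then obtain a b where ab: "a \<noteq> b" "{e \<in> T. 3 * w \<in> e} = {{3 * w, a}, {3 * w, b}}"
      by (rule tour_incident_edges[OF tour])
    then have inT: "{3 * w, a} \<in> T" "{3 * w, b} \<in> T" by blast+
    have "{3 * w, 3 * w + 1} \<in> {{3 * w, a}, {3 * w, b}}"
      using mids[OF that] unfolding ab(2)[symmetric] by simp
    then have "a = 3 * w + 1 \<or> b = 3 * w + 1" by (auto simp: doubleton_eq_iff)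
    then have "\<exists>c. c \<noteq> 3 * w + 1 \<and> {3 * w, c} \<in> T \<and> {a, b} = {c, 3 * w + 1}"
    proof
      assume "a = 3 * w + 1"
      then show ?thesis using ab(1) inT by (intro exI[of _ b]) auto
    next
      assume "b = 3 * w + 1"
      then show ?thesis using ab(1) inT by (intro exI[of _ a]) auto
    qed
    then obtain c where c: "c \<noteq> 3 * w + 1" "{3 * w, c} \<in> T" "{a, b} = {c, 3 * w + 1}" by blast
    then obtain u where u: "c = 3 * u + 2" using inn by blast
    have "u' = u" if u': "arc_edge u' w \<in> T" for u'
    proof -
      have "arc_edge u' w \<in> {{3 * w, a}, {3 * w, b}}"
        unfolding ab(2)[symmetric] using u' by (simp add: arc_edge_def)
      then have "3 * u' + 2 \<in> {a, b}" unfolding arc_edge_def by (auto simp: doubleton_eq_iff)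
      then have "3 * u' + 2 = 3 * u + 2 \<or> 3 * u' + 2 = 3 * w + 1" unfolding c(3) u by blast
      then show ?thesis by presburger
    qed
    moreover have "arc_edge u w \<in> T" using c u unfolding arc_edge_def by (simp add: insert_commute)
    ultimately show ?thesis by blast
  qed
qed


section \<open>The layered digraph and its states\<close>

locale redundant_counter =
  fixes k n :: nat
  assumes n_pos: "0 < n"
begin

text \<open>Chosen to exceed \<open>4 * 2 ^ k - 2\<close>, the largest deviation considered in
  \<open>lift_diff_bound\<close>.\<close>

definition m :: nat where "m = 2 ^ (k + 2)"

definition M :: nat where "M = n * m"

text \<open>Nodes \<open>2x\<close> form the lane, node \<open>2x + 1\<close> is the token with index \<open>x\<close>.  Layers are numbered
  from \<open>1\<close>; layer \<open>0\<close> consists of the root \<open>2M\<close> alone, whatever the second argument of \<open>node\<close>.\<close>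

definition token :: "nat \<Rightarrow> nat \<Rightarrow> nat" where "token i a = i * m + a"

definition node :: "nat \<Rightarrow> nat \<Rightarrow> nat" where
  "node i a = (case i of 0 \<Rightarrow> 2 * M | Suc j \<Rightarrow> 2 * token j a + 1)"

definition digit :: "nat \<Rightarrow> nat \<Rightarrow> int" where
  "digit a b = (int b - 2 * int a) mod int m"

definition in_layer :: "nat \<Rightarrow> nat \<Rightarrow> bool" where
  "in_layer i a \<longleftrightarrow> (if i = 0 then a = 0 else a < m)"

text \<open>A token is visited either as a detour of the lane (\<open>park\<close>,
  \<open>unpark\<close>) or from the layer before it, in which case the lane uses
  \<open>bypass\<close>. The lane ends in the root \<open>2 * M\<close>, and \<open>close\<close>
  leads from the last layer back to its start.\<close>

inductive arc :: "nat \<Rightarrow> nat \<Rightarrow> bool" where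
  park: "x < M \<Longrightarrow> arc (2 * x) (2 * x + 1)"
| unpark: "x < M \<Longrightarrow> arc (2 * x + 1) (2 * x + 2)"
| bypass: "x < M \<Longrightarrow> arc (2 * x) (2 * x + 2)"
| transition: "i < n \<Longrightarrow> in_layer i a \<Longrightarrow> b < m \<Longrightarrow> digit a b \<le> 2 \<Longrightarrow> arc (node i a) (node (Suc i) b)"
| close: "a < m \<Longrightarrow> arc (node n a) 0"

definition valid :: "(nat \<Rightarrow> nat) \<Rightarrow> bool" where
  "valid s \<longleftrightarrow> (\<forall>i\<le>n. in_layer i (s i)) \<and> (\<forall>i<n. digit (s i) (s (Suc i)) \<le> 2)"

text \<open>Layer \<open>Suc i\<close> owns the tokens of block \<open>i\<close>, because layer 0
  has no tokens.\<close>

definition selected :: "(nat \<Rightarrow> nat) \<Rightarrow> nat set" where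
  "selected s = (\<lambda>i. token i (s (Suc i))) ` {..<n}"

text \<open>The successor relation of the intended tour: the lane with detours to all unselected
  tokens, then the path from the root through the layers.\<close>

inductive follows :: "(nat \<Rightarrow> nat) \<Rightarrow> nat \<Rightarrow> nat \<Rightarrow> bool" for s where
  park: "x < M \<Longrightarrow> x \<notin> selected s \<Longrightarrow> follows s (2 * x) (2 * x + 1)"
| unpark: "x < M \<Longrightarrow> x \<notin> selected s \<Longrightarrow> follows s (2 * x + 1) (2 * x + 2)"
| bypass: "x < M \<Longrightarrow> x \<in> selected s \<Longrightarrow> follows s (2 * x) (2 * x + 2)"
| transition: "i < n \<Longrightarrow> follows s (node i (s i)) (node (Suc i) (s (Suc i)))"
| close: "follows s (node n (s n)) 0"

definition state_tour :: "(nat \<Rightarrow> nat) \<Rightarrow> nat set set" where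
  "state_tour s = node_edges (2 * M) \<union> {arc_edge u w | u w. follows s u w}"

text \<open>These are the edges that carry no penalty in \<open>inst\<close>.\<close>

definition allowed_edges :: "nat set set" where
  "allowed_edges = node_edges (2 * M) \<union> {arc_edge u w | u w. arc u w}"

lemma m_ge: "4 \<le> m"
  unfolding m_def by simp

lemma node_simps [simp]: "node 0 a = 2 * M" "node (Suc j) a = 2 * token j a + 1"
  by (simp_all add: node_def)

lemma digit_nonneg: "0 \<le> digit a b"
  unfolding digit_def using m_ge by simp

lemma validD:
  assumes "valid s"
  shows "i \<le> n \<Longrightarrow> in_layer i (s i)" "s 0 = 0" "i < n \<Longrightarrow> s (Suc i) < m"
    "i < n \<Longrightarrow> digit (s i) (s (Suc i)) \<le> 2"
  using assms unfolding valid_def in_layer_def by auto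

lemma parity_distinct [simp]:
  fixes x y :: nat
  shows "Suc (2 * x) \<noteq> 2 * y" "2 * y \<noteq> Suc (2 * x)"
  by presburger+

lemma node_last [simp]: "node n a = 2 * token (n - 1) a + 1"
  using n_pos by (auto simp: node_def split: nat.split)

lemma token_less:
  assumes "i < n" "a < m"
  shows "token i a < M"
proof -
  have "token i a < Suc i * m" using assms(2) by (simp add: token_def)
  also have "\<dots> \<le> M" unfolding M_def using assms(1) by (intro mult_le_mono1) simp
  finally show ?thesis .
qed

lemma token_eq_iff:
  assumes "a < m" "b < m"
  shows "token i a = token j b \<longleftrightarrow> i = j \<and> a = b"
proof -
  have "token i a div m = i" "token i a mod m = a" "token j b div m = j" "token j b mod m = b"
    using assms by (simp_all add: token_def)
  then show ?thesis by metis
qed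

lemma token_exhaust:
  assumes "x < M"
  obtains i a where "i < n" "a < m" "x = token i a"
proof
  show "x div m < n" using assms unfolding M_def by (simp add: less_mult_imp_div_less)
  show "x mod m < m" using m_ge by simp
  show "x = token (x div m) (x mod m)" by (simp add: token_def)
qed

lemma selected_iff:
  assumes "valid s" "i < n" "a < m"
  shows "token i a \<in> selected s \<longleftrightarrow> a = s (Suc i)"
  unfolding selected_def using assms validD(3)[OF assms(1)] by (auto simp: token_eq_iff)

lemma node_le: "i \<le> n \<Longrightarrow> in_layer i a \<Longrightarrow> node i a \<le> 2 * M"
  using token_less[of "i - 1" a] by (cases i) (auto simp: in_layer_def)

lemma node_eq_iff:
  assumes "in_layer i a" "in_layer j b"
  shows "node i a = node j b \<longleftrightarrow> i = j \<and> a = b"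
  using assms by (cases i; cases j) (auto simp: in_layer_def token_eq_iff)

lemma arc_evenD:
  assumes "arc (2 * x) w" "x < M"
  shows "w = 2 * x + 1 \<or> w = 2 * x + 2"
  using assms
proof (cases rule: arc.cases)
  case (transition i a b)
  then show ?thesis using assms(2) by (cases i) auto
qed auto

lemma arc_nodeD:
  assumes "arc (node i a) w" "i \<le> n" "in_layer i a"
  shows "(0 < i \<and> w = node i a + 1) \<or> (i < n \<and> (\<exists>b<m. w = node (Suc i) b \<and> digit a b \<le> 2)) \<or> (i = n \<and> w = 0)"
  using assms(1)
proof (cases rule: arc.cases)
  case (park x)
  then show ?thesis using assms by (cases i) auto
next
  case (unpark x)
  then show ?thesis using assms by (cases i) auto
next
  case (bypass x)
  then show ?thesis using assms by (cases i) auto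
next
  case (transition j c b)
  then have "i = j" "a = c" using assms(3) node_eq_iff by blast+
  then show ?thesis using transition by auto
next
  case (close c)
  then have "i = n" using assms(3) node_eq_iff[of i a n c] n_pos by (auto simp: in_layer_def)
  then show ?thesis using close by auto
qed

lemma arc_into_laneD:
  assumes "arc u (2 * x + 2)"
  shows "u = 2 * x \<or> u = 2 * x + 1"
proof -
  have "2 * x + 2 = 2 * Suc x" by simp
  with assms have "arc u (2 * Suc x)" by simp
  then show ?thesis by (cases rule: arc.cases) auto
qed

lemma arc_into_nodeD:
  assumes "arc u (node (Suc i) b)" "i < n" "b < m"
  shows "Suc u = node (Suc i) b \<or> (\<exists>a. in_layer i a \<and> u = node i a \<and> digit a b \<le> 2)"
  using assms(1)
proof (cases rule: arc.cases)
  case (transition j a c)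
  then have "j = i" "c = b" using assms(3) by (auto simp: token_eq_iff)
  then show ?thesis using transition by auto
next
  case (unpark x)
  then have "2 * token i b + 1 = 2 * Suc x" by simp
  then show ?thesis by presburger
next
  case (bypass x)
  then have "2 * token i b + 1 = 2 * Suc x" by simp
  then show ?thesis by presburger
qed auto

section \<open>Successor functions along arcs come from states\<close>

lemma follows_arc:
  assumes "valid s" "follows s u w"
  shows "arc u w"
  using assms(2)
proof (cases rule: follows.cases)
  case (transition i)
  then show ?thesis using validD[OF assms(1)] arc.transition[of i "s i" "s (Suc i)"] by auto
next
  case close
  then show ?thesis using validD(1)[OF assms(1), of n] n_pos arc.close[of "s n"] by (auto simp: in_layer_def)
qed (auto simp: arc.park[simplified] arc.unpark[simplified] arc.bypass[simplified])

lemma arc_le: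
  assumes "arc u w"
  shows "u \<le> 2 * M" "w \<le> 2 * M"
proof -
  have "u \<le> 2 * M \<and> w \<le> 2 * M" using assms
  proof (cases rule: arc.cases)
    case (transition i a b)
    then show ?thesis using node_le[of i a] node_le[of "Suc i" b] by (auto simp: in_layer_def)
  next
    case (close a)
    then show ?thesis using node_le[of n a] n_pos by (auto simp: in_layer_def)
  qed auto
  then show "u \<le> 2 * M" "w \<le> 2 * M" by auto
qed

lemma follows_total:
  assumes "valid s" "u \<le> 2 * M"
  shows "\<exists>w. follows s u w"
proof (cases "even u")
  case True
  then obtain x where x: "u = 2 * x" by blast
  show ?thesis
  proof (cases "x = M")
    case True
    then show ?thesis using follows.transition[OF n_pos, of s] x by auto
  next
    case False
    then have "x < M" using assms x by simp
    then show ?thesis using follows.park follows.bypass x by (cases "x \<in> selected s") blast+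
  qed
next
  case False
  then obtain x where x: "u = 2 * x + 1" by (elim oddE)
  then have "x < M" using assms by simp
  then obtain i a where i: "i < n" "a < m" "x = token i a" by (rule token_exhaust)
  show ?thesis
  proof (cases "x \<in> selected s")
    case True
    then have "a = s (Suc i)" using selected_iff assms i by simp
    then have u: "u = node (Suc i) (s (Suc i))" using x i by simp
    show ?thesis
    proof (cases "Suc i = n")
      case True
      then show ?thesis using u follows.close[of s] by metis
    next
      case False
      then show ?thesis using u follows.transition[of "Suc i" s] i by auto
    qed
  next
    case False
    then show ?thesis using follows.unpark \<open>x < M\<close> x by blast
  qed
qed

text \<open>An arc enters a token either from its own lane node or from the previous layer.  Hence the
  nodes reached from the root avoid the lane, and no other token is entered from a layer.\<close>

lemma successor_relation_follows:
  assumes arc: "\<And>u w. F u w \<Longrightarrow> arc u w"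
    and out: "\<And>u. u \<le> 2 * M \<Longrightarrow> \<exists>!w. F u w"
    and inn: "\<And>w. w \<le> 2 * M \<Longrightarrow> \<exists>!u. F u w"
  shows "\<exists>s. valid s \<and> (\<forall>u w. F u w \<longleftrightarrow> follows s u w)"
proof -
  have out_eq: "w = w'" if "F u w" "F u w'" for u w w'
    using that arc_le(1)[OF arc[OF that(1)]] out by blast
  have in_eq: "u = u'" if "F u w" "F u' w" for u u' w
    using that arc_le(2)[OF arc[OF that(1)]] inn by blast
  \<comment> \<open>For positive \<open>i\<close>, \<open>node i a - 1\<close> is the lane node in
    front of the token. The guards make \<open>P\<close> and \<open>Q\<close> trivial beyond the
    last layer, so that dependent choice yields a function on all of \<open>nat\<close>.\<close>
  define P where "P i a \<longleftrightarrow> (i \<le> n \<longrightarrow> in_layer i a \<and> (0 < i \<longrightarrow> \<not> F (node i a - 1) (node i a)))" for i a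
  define Q where "Q i a b \<longleftrightarrow> (i < n \<longrightarrow> F (node i a) (node (Suc i) b) \<and> digit a b \<le> 2)" for i a b
  have skip_lane: "F (2 * token i a) (2 * token i a + 2)" if "P (Suc i) a" "i < n" for i a
  proof -
    have a: "a < m" "\<not> F (2 * token i a) (2 * token i a + 1)"
      using that unfolding P_def in_layer_def by auto
    have less: "token i a < M" using token_less that a by simp
    then obtain w where "F (2 * token i a) w" using out[of "2 * token i a"] by auto
    then show ?thesis using arc_evenD[OF arc less] a by metis
  qed
  have escape: "(i < n \<and> (\<exists>b<m. w = node (Suc i) b \<and> digit a b \<le> 2)) \<or> (i = n \<and> w = 0)"
    if "P i a" "i \<le> n" "F (node i a) w" for i a w
  proof -
    \<comment> \<open>If the path returned to the lane here, the next lane node would have two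
      predecessors, since the lane already bypasses this token.\<close>
    have "\<not> (0 < i \<and> w = node i a + 1)"
    proof
      assume *: "0 < i \<and> w = node i a + 1"
      then obtain j where j: "i = Suc j" by (cases i) auto
      have "F (2 * token j a) (2 * token j a + 2)" using skip_lane that j by simp
      moreover have "F (2 * token j a + 1) (2 * token j a + 2)" using * that j by simp
      ultimately show False using in_eq by fastforce
    qed
    then show ?thesis using arc_nodeD[OF arc[OF that(3)] that(2)] that unfolding P_def by blast
  qed
  have "\<exists>b. P (Suc i) b \<and> Q i a b" if P: "P i a" for i a
  proof (cases "i < n")
    case True
    then have "node i a \<le> 2 * M" using P node_le unfolding P_def by simp
    then obtain w where w: "F (node i a) w" using out by blast
    then obtain b where b: "b < m" "w = node (Suc i) b" "digit a b \<le> 2"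
      using escape[OF P _ w] True by auto
    \<comment> \<open>Predecessors are unique, and \<open>node i a\<close> is not the lane node of
      the new token.\<close>
    have "\<not> F (node (Suc i) b - 1) (node (Suc i) b)"
    proof
      assume "F (node (Suc i) b - 1) (node (Suc i) b)"
      then have "node i a = 2 * token i b" using in_eq w b by fastforce
      then show False using token_less[OF True b(1)] by (cases i) auto
    qed
    then show ?thesis using b w unfolding P_def Q_def in_layer_def by auto
  next
    case False
    then show ?thesis unfolding P_def Q_def by auto
  qed
  moreover have "\<exists>a. P 0 a" unfolding P_def in_layer_def by auto
  ultimately obtain s where s: "\<And>i. P i (s i)" "\<And>i. Q i (s i) (s (Suc i))"
    using dependent_nat_choice[of P Q] by blast
  have valid: "valid s" using s unfolding valid_def P_def Q_def by auto
  have park: "F (2 * token i a) (2 * token i a + 1) \<and> F (2 * token i a + 1) (2 * token i a + 2)"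
    if i: "i < n" "a < m" "a \<noteq> s (Suc i)"
      and layer: "\<And>c. c \<noteq> s i \<Longrightarrow> in_layer i c \<Longrightarrow> F (node i c) (node (Suc i) a) \<Longrightarrow> False" for i a
  proof -
    have less: "token i a < M" using token_less i by simp
    obtain u where u: "F u (node (Suc i) a)" using inn[of "node (Suc i) a"] less by auto
    \<comment> \<open>By \<open>layer\<close> a predecessor in the layer below could only be
      \<open>s i\<close>, but the successor of that node is already the selected token.\<close>
    have "Suc u = node (Suc i) a"
    proof (rule ccontr)
      assume "Suc u \<noteq> node (Suc i) a"
      then obtain c where c: "in_layer i c" "u = node i c" using arc_into_nodeD[OF arc[OF u] i(1,2)] by blast
      then have "c = s i" using layer u by blast
      then have "node (Suc i) a = node (Suc i) (s (Suc i))" using u c s(2)[of i] i out_eq unfolding Q_def by blast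
      then show False using i validD(3)[OF valid i(1)] by (auto simp: token_eq_iff)
    qed
    then have F1: "F (2 * token i a) (2 * token i a + 1)" using u by simp
    obtain u' where u': "F u' (2 * token i a + 2)" using inn[of "2 * token i a + 2"] less by auto
    have "u' \<noteq> 2 * token i a"
    proof
      assume "u' = 2 * token i a"
      then have "2 * token i a + 1 = 2 * token i a + 2" using out_eq[OF F1] u' by blast
      then show False by simp
    qed
    then have "u' = 2 * token i a + 1" using arc_into_laneD[OF arc[OF u']] by blast
    then show ?thesis using F1 u' by simp
  qed
  \<comment> \<open>Induction over the layers: unselected tokens of one layer return to the lane, so
    none of them can enter the next layer. Layer 0 contains nothing but the root.\<close>
  have lane: "F (2 * token i a) (2 * token i a + 1) \<and> F (2 * token i a + 1) (2 * token i a + 2)"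
    if "i < n" "a < m" "a \<noteq> s (Suc i)" for i a
    using that
  proof (induction i arbitrary: a)
    case (Suc i)
    show ?case
    proof (rule park)
      fix c assume c: "c \<noteq> s (Suc i)" "in_layer (Suc i) c" "F (node (Suc i) c) (node (Suc (Suc i)) a)"
      then have "F (2 * token i c + 1) (2 * token i c + 2)" using Suc unfolding in_layer_def by simp
      then show False using out_eq[OF c(3)] by fastforce
    qed (use Suc in auto)
  next
    case 0
    show ?case
      by (rule park) (use 0 validD(2)[OF valid] in \<open>auto simp: in_layer_def\<close>)
  qed
  have "F u w" if "follows s u w" for u w
    using that
  proof (cases rule: follows.cases)
    case (park x)
    then obtain i a where i: "i < n" "a < m" "x = token i a" using token_exhaust by metis
    then show ?thesis using lane[of i a] park selected_iff[OF valid] by auto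
  next
    case (unpark x)
    then obtain i a where i: "i < n" "a < m" "x = token i a" using token_exhaust by metis
    then show ?thesis using lane[of i a] unpark selected_iff[OF valid] by auto
  next
    case (bypass x)
    then obtain i where "i < n" "x = token i (s (Suc i))" unfolding selected_def by auto
    then show ?thesis using skip_lane[OF s(1)] bypass by simp
  next
    case (transition i)
    then show ?thesis using s(2)[of i] unfolding Q_def by simp
  next
    case close
    have "node n (s n) \<le> 2 * M" using node_le[of n "s n"] s(1)[of n] unfolding P_def by (simp del: node_last)
    then obtain w' where "F (node n (s n)) w'" using out by blast
    then show ?thesis using escape[OF s(1)[of n]] close by auto
  qed
  \<comment> \<open>The converse inclusion is free: \<open>follows s\<close> offers a successor,
    which is also an \<open>F\<close>-successor, and these are unique.\<close>
  moreover have "follows s u w" if "F u w" for u w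
    using follows_total[OF valid arc_le(1)[OF arc[OF that]]] calculation out_eq[OF that] by blast
  ultimately show ?thesis using valid by blast
qed

lemma tour_is_state_tour:
  assumes "is_tour G T" "verts G = {..<3 * (2 * M) + 3}" "T \<subseteq> allowed_edges"
  obtains s where "valid s" "T = state_tour s"
proof -
  note split = split_tour_functional[OF assms(1,2) assms(3)[unfolded allowed_edges_def]]
  have "arc u w" if "arc_edge u w \<in> T" for u w
    using subsetD[OF assms(3) that] arc_edge_notin_node_edges unfolding allowed_edges_def
    by (auto simp: arc_edge_eq_iff)
  then obtain s where s: "valid s" "\<And>u w. arc_edge u w \<in> T \<longleftrightarrow> follows s u w"
    using successor_relation_follows[of "\<lambda>u w. arc_edge u w \<in> T", OF _ split(2,3)] by blast
  have "T = state_tour s"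
    using split(1) s(2) assms(3) unfolding state_tour_def allowed_edges_def by blast
  then show ?thesis using that s by blast
qed

section \<open>States yield Hamiltonian cycles\<close>

primrec lane :: "(nat \<Rightarrow> nat) \<Rightarrow> nat \<Rightarrow> nat list" where
  "lane s 0 = [0]"
| "lane s (Suc x) = lane s x @ (if x \<in> selected s then [] else [2 * x + 1]) @ [2 * x + 2]"

text \<open>\<open>route s n\<close> lists the nodes in tour order: the lane ends in the root, where
  the path through the layers begins.\<close>

primrec route :: "(nat \<Rightarrow> nat) \<Rightarrow> nat \<Rightarrow> nat list" where
  "route s 0 = lane s M"
| "route s (Suc i) = route s i @ [node (Suc i) (s (Suc i))]"

lemma lane_ends: "lane s x \<noteq> []" "hd (lane s x) = 0" "last (lane s x) = 2 * x"
proof -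
  show ne: "lane s x \<noteq> []" for x by (cases x) auto
  show "hd (lane s x) = 0" by (induction x) (auto simp: hd_append ne)
  show "last (lane s x) = 2 * x" by (cases x) auto
qed

lemma set_lane: "v \<in> set (lane s x) \<longleftrightarrow> v \<le> 2 * x \<and> (odd v \<longrightarrow> v div 2 \<notin> selected s)"
proof (induction x)
  case (Suc x)
  have "v \<le> 2 * Suc x \<longleftrightarrow> v \<le> 2 * x \<or> v = 2 * x + 1 \<or> v = 2 * x + 2" by auto
  then show ?case using Suc by auto
qed auto

lemma distinct_lane: "distinct (lane s x)"
  by (induction x) (auto simp: set_lane)

lemma successively_lane: "x \<le> M \<Longrightarrow> successively (follows s) (lane s x)"
  by (induction x) (auto simp: successively_append_iff lane_ends intro: follows.intros[simplified])

lemma route_ends: "route s i \<noteq> []" "hd (route s i) = 0" "valid s \<Longrightarrow> last (route s i) = node i (s i)"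
proof -
  show ne: "route s i \<noteq> []" for i by (cases i) (auto simp: lane_ends)
  show "hd (route s i) = 0" by (induction i) (auto simp: hd_append lane_ends ne)
  show "last (route s i) = node i (s i)" by (cases i) (auto simp: lane_ends)
qed

lemma set_route: "set (route s i) = set (lane s M) \<union> (\<lambda>j. node (Suc j) (s (Suc j))) ` {..<i}"
  by (induction i) (auto simp: lessThan_Suc)

lemma distinct_route:
  assumes "valid s"
  shows "i \<le> n \<Longrightarrow> distinct (route s i)"
proof (induction i)
  case (Suc i)
  have "node (Suc i) (s (Suc i)) \<noteq> node (Suc j) (s (Suc j))" if "j < i" for j
    using that Suc.prems validD(1)[OF assms] by (subst node_eq_iff) auto
  then show ?case using Suc by (auto simp: set_route set_lane selected_def)
qed (auto simp: distinct_lane)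

lemma successively_route:
  assumes "valid s"
  shows "i \<le> n \<Longrightarrow> successively (follows s) (route s i)"
proof (induction i)
  case (Suc i)
  then show ?case using follows.transition[of i s] route_ends[of s i] assms
    by (auto simp: successively_append_iff simp del: node_simps)
qed (auto simp: successively_lane)

lemma set_route_n:
  assumes "valid s"
  shows "set (route s n) = {..2 * M}"
proof (intro equalityI subsetI)
  fix v assume "v \<in> set (route s n)"
  then show "v \<in> {..2 * M}" using validD[OF assms] token_less by (fastforce simp: set_route set_lane)
next
  fix v assume "v \<in> {..2 * M}"
  show "v \<in> set (route s n)"
  proof (cases "odd v \<and> v div 2 \<in> selected s")
    case True
    then obtain i where "i < n" "v div 2 = token i (s (Suc i))" unfolding selected_def by auto
    moreover have "odd v" using True by simp
    then have "v = 2 * (v div 2) + 1" by presburger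
    ultimately show ?thesis by (auto simp: set_route)
  next
    case False
    then show ?thesis using \<open>v \<in> {..2 * M}\<close> by (auto simp: set_route set_lane)
  qed
qed

lemma arc_edge_in_state_tour: "arc_edge u w \<in> state_tour s \<longleftrightarrow> follows s u w"
  using arc_edge_notin_node_edges unfolding state_tour_def by (auto simp: arc_edge_eq_iff)

text \<open>Bypass arcs identify the selected tokens, so a state can be read off its tour.\<close>

lemma follows_bypassD:
  assumes "follows s (2 * x) (2 * x + 2)" "x < M"
  shows "x \<in> selected s"
  using assms(1)
proof (cases rule: follows.cases)
  case (transition i)
  then show ?thesis using assms(2) by (cases i) auto
qed auto

lemma state_tour_cong:
  assumes "\<And>i. i \<le> n \<Longrightarrow> s i = s' i"
  shows "state_tour s = state_tour s'"
proof -
  have imp: "follows s' u w" if "follows s u w" "\<And>i. i \<le> n \<Longrightarrow> s i = s' i" for s s' u w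
  proof -
    have "selected s = selected s'" unfolding selected_def using that(2) by (auto intro!: image_cong)
    with that(1) show ?thesis
      using that(2) follows.intros[where s = s'] by (cases rule: follows.cases) (auto simp del: node_simps node_last)
  qed
  have "follows s u w \<longleftrightarrow> follows s' u w" for u w using imp assms by metis
  then show ?thesis unfolding state_tour_def by simp
qed

text \<open>The cycle along \<open>route s n\<close> is a tour inside \<open>state_tour s\<close>.
  By the classification it equals \<open>state_tour s'\<close> for some \<open>s'\<close>, and its
  bypass arcs show that \<open>s'\<close> agrees with \<open>s\<close> up to layer \<open>n\<close>,
  which gives equality.\<close>

lemma is_tour_state_tour:
  assumes valid: "valid s" and verts: "verts G = {..<3 * (2 * M) + 3}"
  shows "is_tour G (state_tour s)"
proof -
  define xs where "xs = route s n"
  have xs: "xs \<noteq> []" "set xs = {..2 * M}" "distinct xs" "hd xs = 0" "last xs = node n (s n)"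
    using route_ends set_route_n distinct_route valid unfolding xs_def by auto
  have sub: "cycle_edges (expand xs) \<subseteq> state_tour s"
  proof (rule cycle_edges_subset)
    have "successively (\<lambda>u w. arc_edge u w \<in> state_tour s) xs"
      using successively_route[OF valid] unfolding xs_def arc_edge_in_state_tour by simp
    then show "successively (\<lambda>a b. {a, b} \<in> state_tour s) (expand xs)"
      by (rule successively_expand[where N = "2 * M"]) (auto simp: xs(2) state_tour_def)
    show "{last (expand xs), hd (expand xs)} \<in> state_tour s"
      using arc_edge_in_state_tour[of "last xs" "hd xs" s] follows.close[of s] xs
      unfolding expand_ends[OF xs(1)] arc_edge_def by simp
  qed
  have tour: "is_tour G (cycle_edges (expand xs))"
    unfolding is_tour_def
  proof (intro exI conjI)
    show "set (expand xs) = verts G" unfolding set_expand xs verts by auto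
    show "distinct (expand xs)" using distinct_expand xs by simp
    then have "length (expand xs) = card (verts G)"
      using \<open>set (expand xs) = verts G\<close> distinct_card by metis
    then show "3 \<le> length (expand xs)" using verts by simp
  qed simp
  have "state_tour s \<subseteq> allowed_edges"
    using follows_arc[OF valid] unfolding state_tour_def allowed_edges_def by auto
  with sub tour obtain s' where s': "valid s'" "cycle_edges (expand xs) = state_tour s'"
    using tour_is_state_tour verts by (metis subset_trans)
  have "s' i = s i" if "i \<le> n" for i
  proof (cases i)
    case 0
    then show ?thesis using validD(2)[OF valid] validD(2)[OF s'(1)] by simp
  next
    case (Suc j)
    have j: "j < n" "s' (Suc j) < m" using validD(3)[OF s'(1)] that Suc by auto
    then have less: "token j (s' (Suc j)) < M" by (rule token_less)
    have "token j (s' (Suc j)) \<in> selected s'" using selected_iff s'(1) j by simp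
    from follows.bypass[OF less this] show ?thesis
      using sub s'(2) follows_bypassD less selected_iff[OF valid j] Suc
      by (metis arc_edge_in_state_tour subsetD)
  qed
  then show ?thesis using tour s'(2) state_tour_cong by metis
qed

section \<open>Weights and costs\<close>

definition transitions :: "(nat \<times> nat \<times> nat) set" where
  "transitions = {(i, a, b). i < n \<and> in_layer i a \<and> b < m \<and> digit a b \<le> 2}"

fun transition_edge :: "nat \<times> nat \<times> nat \<Rightarrow> nat set" where
  "transition_edge (i, a, b) = arc_edge (node i a) (node (Suc i) b)"

fun price :: "nat \<times> nat \<times> nat \<Rightarrow> real" where
  "price (i, a, b) = 3 ^ (n - i) * (2 - real_of_int (digit a b))"

definition cost :: "(nat \<Rightarrow> nat) \<Rightarrow> real" where
  "cost s = (\<Sum>i<n. price (i, s i, s (Suc i)))"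

text \<open>More than the cost of the all-zero start, so a run from there never reaches a tour with
  a forbidden edge.\<close>

definition penalty :: real where
  "penalty = cost (\<lambda>_. 0) + 1"

text \<open>At most one transition has a given edge, so the sum looks up its price, with default
  0.\<close>

definition inst :: tsp_instance where
  "inst = \<lparr>verts = {..<3 * (2 * M) + 3},
     weight = (\<lambda>e. (\<Sum>q \<in> {q \<in> transitions. transition_edge q = e}. price q)
                    + (if e \<in> allowed_edges then 0 else penalty))\<rparr>"

lemma finite_transitions: "finite transitions"
proof (rule finite_subset)
  show "transitions \<subseteq> {..n} \<times> {..m} \<times> {..m}"
    unfolding transitions_def in_layer_def by (auto split: if_splits)
qed auto

lemma valid_zero: "valid (\<lambda>_. 0)"
  using m_ge unfolding valid_def in_layer_def digit_def by simp

lemma price_nonneg: "q \<in> transitions \<Longrightarrow> 0 \<le> price q"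
  unfolding transitions_def by auto

lemma cost_nonneg: "valid s \<Longrightarrow> 0 \<le> cost s"
  unfolding cost_def using validD by (intro sum_nonneg) auto

lemma weight_nonneg: "0 \<le> weight inst e"
  unfolding inst_def penalty_def using cost_nonneg[OF valid_zero]
  by (auto intro!: add_nonneg_nonneg sum_nonneg price_nonneg)

lemma penalty_le_weight: "e \<notin> allowed_edges \<Longrightarrow> penalty \<le> weight inst e"
  unfolding inst_def by (auto intro!: sum_nonneg price_nonneg)

lemma state_tour_allowed: "valid s \<Longrightarrow> state_tour s \<subseteq> allowed_edges"
  using follows_arc unfolding state_tour_def allowed_edges_def by blast

lemma transition_edge_in_state_tour:
  assumes "valid s" "(i, a, b) \<in> transitions"
  shows "transition_edge (i, a, b) \<in> state_tour s \<longleftrightarrow> a = s i \<and> b = s (Suc i)"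
proof
  have q: "i < n" "in_layer i a" "b < m" using assms(2) unfolding transitions_def by auto
  assume "transition_edge (i, a, b) \<in> state_tour s"
  then have "follows s (node i a) (node (Suc i) b)" by (simp add: arc_edge_in_state_tour)
  then show "a = s i \<and> b = s (Suc i)"
  proof (cases rule: follows.cases)
    case (park x)
    then show ?thesis by (cases i) auto
  next
    case (unpark x)
    then have "2 * token i b + 1 = 2 * Suc x" by simp
    then show ?thesis by presburger
  next
    case (bypass x)
    then have "2 * token i b + 1 = 2 * Suc x" by simp
    then show ?thesis by presburger
  next
    case (transition j)
    have "in_layer j (s j)" using validD(1)[OF assms(1)] transition(3) by simp
    then have "i = j" "a = s j" using transition(1) q(2) node_eq_iff by blast+
    then show ?thesis using transition q validD(3)[OF assms(1)] by (auto simp: token_eq_iff)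
  qed auto
next
  assume "a = s i \<and> b = s (Suc i)"
  then show "transition_edge (i, a, b) \<in> state_tour s"
    using assms(2) follows.transition[of i s] unfolding transitions_def
    by (simp add: arc_edge_in_state_tour del: node_simps)
qed

lemma is_tour_inst_state_tour: "valid s \<Longrightarrow> is_tour inst (state_tour s)"
  by (rule is_tour_state_tour) (auto simp: inst_def)

text \<open>Allowed edges cost nothing beyond transition prices, and the transitions on the tour are
  exactly the \<open>n\<close> steps of the path. The double sum is regrouped by the fibres of
  \<open>transition_edge\<close>.\<close>

lemma total_weight_state_tour:
  assumes "valid s"
  shows "total_weight inst (state_tour s) = cost s"
proof -
  define Q where "Q = {q \<in> transitions. transition_edge q \<in> state_tour s}"
  have "total_weight inst (state_tour s) = (\<Sum>e\<in>state_tour s. \<Sum>q \<in> {q \<in> transitions. transition_edge q = e}. price q)"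
    unfolding total_weight_def inst_def using state_tour_allowed[OF assms] by (auto intro!: sum.cong)
  also have "\<dots> = (\<Sum>e\<in>state_tour s. \<Sum>q \<in> {q \<in> Q. transition_edge q = e}. price q)"
    unfolding Q_def by (intro sum.cong) auto
  also have "\<dots> = (\<Sum>q\<in>Q. price q)"
    using finite_transitions card_tour(1)[OF is_tour_inst_state_tour[OF assms]] unfolding Q_def
    by (intro sum.group) auto
  also have "Q = (\<lambda>i. (i, s i, s (Suc i))) ` {..<n}"
  proof -
    have "(i, s i, s (Suc i)) \<in> transitions" if "i < n" for i
      using that validD[OF assms] unfolding transitions_def by auto
    moreover have "i < n" if "(i, a, b) \<in> transitions" for i a b
      using that unfolding transitions_def by auto
    ultimately show ?thesis
      using transition_edge_in_state_tour[OF assms] unfolding Q_def by (auto simp del: transition_edge.simps)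
  qed
  also have "(\<Sum>q\<in>\<dots>. price q) = cost s"
    unfolding cost_def by (subst sum.reindex) (auto simp: inj_on_def)
  finally show ?thesis .
qed

text \<open>A single forbidden edge already weighs at least \<open>penalty\<close>, and no weight is
  negative.\<close>

lemma cheap_tour_is_state_tour:
  assumes "is_tour inst T" "total_weight inst T < penalty"
  obtains s where "valid s" "T = state_tour s"
proof (rule tour_is_state_tour[OF assms(1)])
  show "verts inst = {..<3 * (2 * M) + 3}" by (simp add: inst_def)
  show "T \<subseteq> allowed_edges"
  proof (rule ccontr)
    assume "\<not> T \<subseteq> allowed_edges"
    then obtain e where e: "e \<in> T" "e \<notin> allowed_edges" by blast
    have "weight inst e \<le> total_weight inst T"
      unfolding total_weight_def using weight_nonneg card_tour(1)[OF assms(1)] e(1)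
      by (intro member_le_sum) auto
    then show False using penalty_le_weight[OF e(2)] assms(2) by simp
  qed
qed (use that in blast)

section \<open>The counter value under swaps\<close>

text \<open>Horner's scheme for the counter value of the first \<open>i\<close> digits.\<close>

primrec lift :: "(nat \<Rightarrow> nat) \<Rightarrow> nat \<Rightarrow> int" where
  "lift s 0 = 0"
| "lift s (Suc i) = 2 * lift s i + digit (s i) (s (Suc i))"

definition changed :: "(nat \<Rightarrow> nat) \<Rightarrow> (nat \<Rightarrow> nat) \<Rightarrow> nat \<Rightarrow> nat set" where
  "changed s s' i = {j. j < i \<and> s (Suc j) \<noteq> s' (Suc j)}"

lemma finite_changed: "finite (changed s s' i)"
  unfolding changed_def by auto

text \<open>Each digit is congruent to \<open>s (Suc i) - 2 * s i\<close>, so the recursion of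
  \<open>lift\<close> reproduces the state modulo \<open>m\<close>. This ties the value to the
  vertex of each layer.\<close>

lemma lift_mod:
  assumes "s 0 = 0"
  shows "int m dvd lift s i - int (s i)"
proof (induction i)
  case (Suc i)
  have "int m dvd digit (s i) (s (Suc i)) - (int (s (Suc i)) - 2 * int (s i))"
    unfolding digit_def by (metis dvd_minus_mod dvd_diff_commute)
  moreover have "lift s (Suc i) - int (s (Suc i)) = 2 * (lift s i - int (s i))
      + (digit (s i) (s (Suc i)) - (int (s (Suc i)) - 2 * int (s i)))" by (simp add: algebra_simps)
  ultimately show ?case using Suc by (metis dvd_add dvd_mult)
qed (use assms in simp)

text \<open>The modulus exceeds every deviation that at most \<open>k\<close> changed layers can build up, so the
  lifts agree again at each unchanged layer.\<close>

lemma lift_diff_bound: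
  assumes valid: "valid s" "valid s'" and card: "card (changed s s' n) \<le> k"
  shows "i \<le> n \<Longrightarrow> \<bar>lift s' i - lift s i\<bar> \<le> 2 * (2 ^ card (changed s s' i) - 1)"
proof (induction i)
  case (Suc i)
  define c where "c = card (changed s s' i)"
  define d where "d = lift s' (Suc i) - lift s (Suc i)"
  have "changed s s' i \<subseteq> changed s s' n" unfolding changed_def using Suc.prems by auto
  then have c_le: "c \<le> k" unfolding c_def using card card_mono[OF finite_changed] by (meson le_trans)
  have "0 \<le> digit (s i) (s (Suc i))" "digit (s i) (s (Suc i)) \<le> 2"
    "0 \<le> digit (s' i) (s' (Suc i))" "digit (s' i) (s' (Suc i)) \<le> 2"
    using digit_nonneg validD(4)[OF valid(1)] validD(4)[OF valid(2)] Suc.prems by auto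
  \<comment> \<open>The old difference doubles and the digits differ by at most 2:
    \<open>2 * (2 * (2 ^ c - 1)) + 2 = 2 * (2 ^ Suc c - 1)\<close>.\<close>
  then have d: "\<bar>d\<bar> \<le> 2 * (2 ^ Suc c - 1)"
    using Suc unfolding c_def[symmetric] d_def by (simp add: abs_le_iff)
  show ?case
  proof (cases "s (Suc i) = s' (Suc i)")
    case False
    then have "changed s s' (Suc i) = insert i (changed s s' i)" unfolding changed_def by (auto simp: less_Suc_eq)
    moreover have "i \<notin> changed s s' i" unfolding changed_def by simp
    ultimately have "card (changed s s' (Suc i)) = Suc c" unfolding c_def using finite_changed by simp
    then show ?thesis using d unfolding d_def by simp
  next
    case True
    \<comment> \<open>Equal vertices make \<open>d\<close> a multiple of \<open>m\<close>, and a
      multiple smaller than \<open>m\<close> in absolute value is 0.\<close>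
    have "int m dvd d"
      using dvd_diff[OF lift_mod[of s' "Suc i"] lift_mod[of s "Suc i"]] validD(2) valid
      unfolding d_def True by (simp del: lift.simps)
    moreover have "\<bar>d\<bar> < int m"
    proof -
      have "\<bar>d\<bar> \<le> 4 * 2 ^ c - 2" using d by simp
      moreover have "(2::int) ^ c \<le> 2 ^ k" using c_le by simp
      moreover have "int m = 4 * 2 ^ k" unfolding m_def by simp
      ultimately show ?thesis by linarith
    qed
    ultimately have "d = 0" by (metis abs_of_nat dvd_imp_le_int linorder_not_less)
    then show ?thesis unfolding d_def by simp
  qed
qed simp

text \<open>Every changed layer loses the bypass arc of its old token, and these arcs are
  distinct.\<close>

lemma card_changed_le:
  assumes valid: "valid s" "valid s'"
  shows "card (changed s s' n) \<le> card (state_tour s - state_tour s')"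
proof (rule card_inj_on_le)
  define f where "f j = arc_edge (2 * token j (s (Suc j))) (2 * token j (s (Suc j)) + 2)" for j
  show "inj_on f (changed s s' n)"
    unfolding f_def inj_on_def changed_def using validD(3)[OF valid(1)]
    by (auto simp: arc_edge_eq_iff token_eq_iff)
  show "f ` changed s s' n \<subseteq> state_tour s - state_tour s'"
  proof (rule image_subsetI)
    fix j assume "j \<in> changed s s' n"
    then have j: "j < n" "s (Suc j) \<noteq> s' (Suc j)" unfolding changed_def by auto
    have less: "s (Suc j) < m" "token j (s (Suc j)) < M" using validD(3)[OF valid(1)] token_less j by auto
    have "token j (s (Suc j)) \<in> selected s" "token j (s (Suc j)) \<notin> selected s'"
      using selected_iff valid j less by auto
    then show "f j \<in> state_tour s - state_tour s'"
      using follows.bypass[OF less(2), of s] follows_bypassD[OF _ less(2), of s']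
      unfolding f_def by (auto simp: arc_edge_in_state_tour)
  qed
  show "finite (state_tour s - state_tour s')"
    using card_tour(1)[OF is_tour_inst_state_tour[OF valid(1)]] by simp
qed

section \<open>The carry step\<close>

text \<open>Under the hypotheses of \<open>valid_advance\<close>, this keeps \<open>lift s n\<close>
  if \<open>Suc i < n\<close> and adds 1 to it if \<open>Suc i = n\<close>.\<close>

definition advance :: "nat \<Rightarrow> (nat \<Rightarrow> nat) \<Rightarrow> (nat \<Rightarrow> nat)" where
  "advance i s = s(Suc i := (s (Suc i) + 1) mod m)"

text \<open>The raised digit is at most 2 and hence below \<open>m\<close>, so it does not wrap
  around.\<close>

lemma digit_advance_right:
  assumes "digit a b < 2"
  shows "digit a ((b + 1) mod m) = digit a b + 1"
proof -
  have "digit a ((b + 1) mod m) = (int b - 2 * int a + 1) mod int m"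
    unfolding digit_def by (simp add: of_nat_mod mod_diff_left_eq algebra_simps)
  also have "\<dots> = (digit a b + 1) mod int m" unfolding digit_def by (simp add: mod_add_left_eq)
  also have "\<dots> = digit a b + 1"
    using assms digit_nonneg[of a b] m_ge by (intro mod_pos_pos_trivial) auto
  finally show ?thesis .
qed

text \<open>The left vertex enters the digit with factor -2, so its increment lowers 2 exactly to
  0.\<close>

lemma digit_advance_left:
  assumes "digit a b = 2"
  shows "digit ((a + 1) mod m) b = 0"
proof -
  have "digit ((a + 1) mod m) b = (int b - 2 * (int a + 1)) mod int m"
    unfolding digit_def
  proof (rule mod_diff_cong[OF refl])
    have "int ((a + 1) mod m) = (int a + 1) mod int m" by (simp add: of_nat_mod add.commute)
    then show "2 * int ((a + 1) mod m) mod int m = 2 * (int a + 1) mod int m"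
      by (simp only: mod_mult_right_eq)
  qed
  also have "\<dots> = (digit a b - 2) mod int m" unfolding digit_def by (simp add: mod_diff_left_eq algebra_simps)
  finally show ?thesis using assms by simp
qed

lemma valid_advance:
  assumes valid: "valid s" and i: "i < n" "digit (s i) (s (Suc i)) < 2"
    and above: "Suc i < n \<Longrightarrow> digit (s (Suc i)) (s (Suc (Suc i))) = 2"
  shows "valid (advance i s)"
  unfolding valid_def
proof (intro conjI allI impI)
  fix j assume "j \<le> n"
  then show "in_layer j (advance i s j)"
    using validD(1)[OF valid] m_ge unfolding advance_def in_layer_def by auto
next
  fix j assume "j < n"
  then show "digit (advance i s j) (advance i s (Suc j)) \<le> 2"
    using validD(4)[OF valid] digit_advance_right[OF i(2)] i digit_advance_left[OF above]
    unfolding advance_def by (cases "j = i"; cases "j = Suc i") auto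
qed

text \<open>Raising digit \<open>i\<close> saves \<open>3 ^ (n - i)\<close>, while resetting the
  next digit costs \<open>2 * 3 ^ (n - Suc i)\<close>, only two thirds of that. In the last layer
  nothing has to be reset.\<close>

lemma cost_advance:
  assumes i: "i < n" "digit (s i) (s (Suc i)) < 2"
    and above: "Suc i < n \<Longrightarrow> digit (s (Suc i)) (s (Suc (Suc i))) = 2"
  shows "cost (advance i s) < cost s"
proof -
  have "price (j, advance i s j, advance i s (Suc j)) - price (j, s j, s (Suc j))
      = (if j = i then - (3 ^ (n - i)) else 0) + (if j = Suc i then 2 * 3 ^ (n - j) else 0)" if "j < n" for j
    using that digit_advance_right[OF i(2)] digit_advance_left[OF above] above
    unfolding advance_def by (cases "j = i"; cases "j = Suc i") (auto simp: algebra_simps)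
  then have "cost (advance i s) - cost s =
      (\<Sum>j<n. (if j = i then - (3 ^ (n - i)) else 0) + (if j = Suc i then 2 * 3 ^ (n - j) else 0))"
    unfolding cost_def by (simp flip: sum_subtractf)
  also have "\<dots> = - (3 ^ (n - i)) + (if Suc i < n then 2 * 3 ^ (n - Suc i) else 0)"
    using i(1) by (simp add: sum.distrib)
  also have "\<dots> < 0"
  proof -
    have "(3::real) ^ (n - i) = 3 * 3 ^ (n - Suc i)" using i(1) by (metis Suc_diff_Suc power_Suc)
    then show ?thesis by simp
  qed
  finally show ?thesis by simp
qed

lemma follows_nodeD:
  assumes valid: "valid s" and "i \<le> n" "follows s (node i (s i)) w"
  shows "(i < n \<and> w = node (Suc i) (s (Suc i))) \<or> (i = n \<and> w = 0)"
  using assms(3)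
proof (cases rule: follows.cases)
  case (unpark z)
  then obtain j where "i = Suc j" "z = token j (s (Suc j))" by (cases i) auto
  then show ?thesis using unpark selected_iff[OF valid, of j] validD(3)[OF valid] assms(2) by auto
next
  case (transition j)
  then have "i = j" using node_eq_iff validD(1)[OF valid] assms(2) by (metis less_imp_le)
  then show ?thesis using transition by auto
next
  case close
  then have "i = n" using node_eq_iff validD(1)[OF valid] assms(2) by (metis order_refl)
  then show ?thesis using close by auto
next
  case (park z)
  then show ?thesis by (cases i) auto
next
  case (bypass z)
  then show ?thesis by (cases i) auto
qed

text \<open>The old token \<open>x\<close> loses its bypass and the arcs into and out of it; the new
  token \<open>y\<close> loses the two arcs of its detour.\<close>

lemma card_advance:
  assumes valid: "valid s" and i: "i < n"
  shows "card (state_tour s - state_tour (advance i s)) \<le> 5"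
proof -
  define x y where "x = token i (s (Suc i))" and "y = token i ((s (Suc i) + 1) mod m)"
  have other: "z \<in> selected (advance i s) \<longleftrightarrow> z \<in> selected s" if "z \<noteq> x" "z \<noteq> y" for z
    using that i unfolding selected_def advance_def x_def y_def by (auto simp: image_iff)
  \<comment> \<open>The target of the last pair is left open, so the pair covers every arc out of
    \<open>x\<close>; it is pinned down below.\<close>
  have follows: "follows (advance i s) u w \<or> (u, w) \<in> {(2 * x, 2 * x + 2), (2 * y, 2 * y + 1), (2 * y + 1, 2 * y + 2),
      (node i (s i), node (Suc i) (s (Suc i))), (2 * x + 1, w)}"
    if "follows s u w" for u w
    using that
  proof (cases rule: follows.cases)
    case (park z)
    have "z \<noteq> x" using park i unfolding x_def selected_def by auto
    then show ?thesis using park other follows.park[of z "advance i s"] by auto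
  next
    case (unpark z)
    have "z \<noteq> x" using unpark i unfolding x_def selected_def by auto
    then show ?thesis using unpark other follows.unpark[of z "advance i s"] by auto
  next
    case (bypass z)
    have "y \<in> selected (advance i s)" using i unfolding y_def selected_def advance_def by auto
    then show ?thesis using bypass other follows.bypass[of z "advance i s"] by auto
  next
    case (transition j)
    then show ?thesis using follows.transition[of j "advance i s"]
      by (cases "j = i"; cases "j = Suc i") (auto simp: advance_def x_def simp del: node_last)
  next
    case close
    show ?thesis
    proof (cases "n = Suc i")
      case True
      then have "u = node (Suc i) (s (Suc i))" using close(1) by metis
      then show ?thesis unfolding x_def by simp
    next
      case False
      then show ?thesis using close follows.close[of "advance i s"] by (simp add: advance_def del: node_last)
    qed
  qed
  \<comment> \<open>The unique successor of \<open>x\<close>; in the last layer it is 0, the target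
    of \<open>close\<close>.\<close>
  define w where "w = (if Suc i = n then 0 else node (Suc (Suc i)) (s (Suc (Suc i))))"
  have w: "w' = w" if "follows s (2 * x + 1) w'" for w'
    using follows_nodeD[OF valid, of "Suc i" w'] that i unfolding w_def x_def by auto
  define E where "E = {arc_edge (2 * x) (2 * x + 2), arc_edge (2 * y) (2 * y + 1), arc_edge (2 * y + 1) (2 * y + 2),
      arc_edge (node i (s i)) (node (Suc i) (s (Suc i))), arc_edge (2 * x + 1) w}"
  have "state_tour s - state_tour (advance i s) \<subseteq> E"
  proof
    fix e assume e: "e \<in> state_tour s - state_tour (advance i s)"
    then obtain u w' where uw: "e = arc_edge u w'" "follows s u w'" "\<not> follows (advance i s) u w'"
      unfolding state_tour_def by auto
    then show "e \<in> E" using follows[OF uw(2)] w unfolding E_def by blast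
  qed
  moreover have "card {a, b, c, d, e} \<le> 5" for a b c d e :: "nat set"
    using card_length[of "[a, b, c, d, e]"] by simp
  then have "card E \<le> 5" unfolding E_def .
  moreover have "finite E" unfolding E_def by simp
  ultimately show ?thesis using card_mono by (meson le_trans)
qed

text \<open>The last digit below 2 is followed by a 2 or by nothing, so a carry applies there. It
  lowers the cost and loses at most five edges, which is where \<open>5 \<le> k\<close>
  enters.\<close>

lemma local_optimum_digits:
  assumes "5 \<le> k" and valid: "valid s" and opt: "local_optimum (TSP_k_Opt k) inst (state_tour s)" and "i < n"
  shows "digit (s i) (s (Suc i)) = 2"
proof (rule ccontr)
  define I where "I = {j. j < n \<and> digit (s j) (s (Suc j)) < 2}"
  assume "digit (s i) (s (Suc i)) \<noteq> 2"
  then have "i \<in> I" "finite I" using validD(4)[OF valid \<open>i < n\<close>] \<open>i < n\<close> unfolding I_def by auto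
  define j where "j = Max I"
  have "j \<in> I" using \<open>i \<in> I\<close> \<open>finite I\<close> unfolding j_def by (intro Max_in) auto
  then have j: "j < n" "digit (s j) (s (Suc j)) < 2" unfolding I_def by auto
  have above: "digit (s (Suc j)) (s (Suc (Suc j))) = 2" if "Suc j < n"
  proof -
    have "Suc j \<notin> I" using Max_ge[OF \<open>finite I\<close>, of "Suc j"] unfolding j_def[symmetric] by auto
    then show ?thesis using that validD(4)[OF valid that] unfolding I_def by auto
  qed
  have valid': "valid (advance j s)" using valid_advance[OF valid j above] .
  have "state_tour (advance j s) \<in> ls_neighbours (TSP_k_Opt k) inst (state_tour s)"
    using card_advance[OF valid j(1)] \<open>5 \<le> k\<close>
    by (intro TSP_neighbourI is_tour_inst_state_tour valid valid') auto
  then have "state_tour (advance j s) \<in> improving_neighbours (TSP_k_Opt k) inst (state_tour s)"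
    using cost_advance[OF j above] is_tour_inst_state_tour[OF valid']
    by (simp add: improving_neighbours_def TSP_k_Opt_def total_weight_state_tour valid valid')
  then show False using opt unfolding local_optimum_def by blast
qed

section \<open>Counting iterations\<close>

lemma lift_max:
  assumes "\<And>i. i < n \<Longrightarrow> digit (s i) (s (Suc i)) = 2"
  shows "i \<le> n \<Longrightarrow> lift s i = 2 * (2 ^ i - 1)"
  by (induction i) (use assms in auto)

lemma lift_zero: "lift (\<lambda>_. 0) i = 0"
  by (induction i) (auto simp: digit_def)

text \<open>The counter value is the potential: it starts at 0, grows by less than
  \<open>2 ^ (k + 1)\<close> per iteration and is \<open>2 * (2 ^ n - 1)\<close> at every local
  optimum reached.\<close>

lemma needs_iterations_state_tour:
  assumes "5 \<le> k" "k < n" "pivot_rule (TSP_k_Opt k) inst p" "L \<le> 2 ^ (n - k - 1)"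
  shows "needs_iterations (TSP_k_Opt k) inst p (state_tour (\<lambda>_. 0)) L"
proof -
  define S where "S = {T. is_tour inst T \<and> total_weight inst T \<le> cost (\<lambda>_. 0)}"
  \<comment> \<open>The choice is not unique, since values beyond layer \<open>n\<close> are
    arbitrary, but \<open>lipschitz\<close> with no lost edges shows that \<open>V\<close> does not
    depend on it.\<close>
  define state where "state T = (SOME s. valid s \<and> T = state_tour s)" for T
  define V where "V T = lift (state T) n" for T
  have state: "valid (state T)" "T = state_tour (state T)" if "T \<in> S" for T
  proof -
    have "\<exists>s. valid s \<and> T = state_tour s"
    proof (rule cheap_tour_is_state_tour)
      show "is_tour inst T" "total_weight inst T < penalty"
        using that unfolding S_def penalty_def by auto
    qed blast
    then have "valid (state T) \<and> T = state_tour (state T)" unfolding state_def by (rule someI_ex)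
    then show "valid (state T)" "T = state_tour (state T)" by blast+
  qed
  have lipschitz: "\<bar>lift s' n - lift s n\<bar> \<le> 2 * (2 ^ card (state_tour s - state_tour s') - 1)"
    if "valid s" "valid s'" "card (state_tour s - state_tour s') \<le> k" for s s'
  proof -
    have le: "card (changed s s' n) \<le> card (state_tour s - state_tour s')" using card_changed_le that by blast
    have "\<bar>lift s' n - lift s n\<bar> \<le> 2 * (2 ^ card (changed s s' n) - 1)"
      using lift_diff_bound[OF that(1,2) _ order_refl] le that(3) by simp
    also have "\<dots> \<le> 2 * (2 ^ card (state_tour s - state_tour s') - 1)" using le by simp
    finally show ?thesis .
  qed
  let ?T0 = "state_tour (\<lambda>_. 0)"
  have T0: "?T0 \<in> S"
    unfolding S_def using is_tour_inst_state_tour total_weight_state_tour valid_zero by simp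
  show ?thesis
  proof (rule needs_iterations_if_lipschitz[where V = V and S = S and D = "2 ^ (k + 1)" and B = "2 ^ (n - k - 1)"])
    \<comment> \<open>The chosen state and the all-zero state have the same tour, so the bound is
      \<open>2 * (2 ^ 0 - 1) = 0\<close>.\<close>
    show "V ?T0 \<le> 0"
      using lipschitz[OF valid_zero state(1)[OF T0]] state(2)[OF T0] unfolding V_def by (simp add: lift_zero)
  next
    fix T T' assume T: "T \<in> S" "T' \<in> improving_neighbours (TSP_k_Opt k) inst T"
    then have nb: "T' \<in> ls_neighbours (TSP_k_Opt k) inst T" and less: "total_weight inst T' < total_weight inst T"
      unfolding improving_neighbours_def by (auto simp: TSP_k_Opt_def)
    have "finite (verts inst)" by (simp add: inst_def)
    note nb = TSP_neighbour_card[OF this nb]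
    then have T': "T' \<in> S" using less T(1) unfolding S_def by simp
    have "card (state_tour (state T) - state_tour (state T')) \<le> k"
      using nb(2) state(2)[OF T(1)] state(2)[OF T'] by simp
    then have "\<bar>V T' - V T\<bar> \<le> 2 * (2 ^ card (state_tour (state T) - state_tour (state T')) - 1)"
      unfolding V_def using lipschitz state(1)[OF T(1)] state(1)[OF T'] by blast
    also have "\<dots> \<le> 2 * (2 ^ k - 1)"
      using \<open>card (state_tour (state T) - state_tour (state T')) \<le> k\<close> by simp
    finally show "T' \<in> S \<and> V T' \<le> V T + 2 ^ (k + 1)" using T' by simp
  next
    fix T assume T: "T \<in> S" "local_optimum (TSP_k_Opt k) inst T"
    have "V T = 2 * (2 ^ n - 1)"
      unfolding V_def using local_optimum_digits[OF \<open>5 \<le> k\<close> state(1)[OF T(1)]] T state(2)[OF T(1)]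
      by (intro lift_max) auto
    moreover have "(2::int) ^ (k + 1) * 2 ^ (n - k - 1) = 2 ^ n"
      using \<open>k < n\<close> unfolding power_add[symmetric] by simp
    \<comment> \<open>This turns \<open>2 * (2 ^ n - 1)\<close> into a value of at least
      \<open>2 ^ n\<close>, the product of the two powers.\<close>
    moreover have "(2::int) \<le> 2 ^ n" using n_pos self_le_power[of "2::int" n] by simp
    ultimately show "2 ^ (k + 1) * 2 ^ (n - k - 1) \<le> V T" by simp
  qed (use assms T0 in \<open>auto simp: S_def TSP_k_Opt_def\<close>)
qed

lemma card_verts_inst: "card (verts inst) = 6 * (n * m) + 3"
  by (simp add: inst_def M_def)

lemma inst_is_instance: "is_tsp_instance inst"
  unfolding is_tsp_instance_def using weight_nonneg by (simp add: inst_def)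

end

theorem theorem1:
  fixes k :: nat
  assumes "k \<ge> 5"
  shows "all_exp_property (TSP_k_Opt k)"
proof -
  define m :: nat where "m = 2 ^ (k + 2)"
  \<comment> \<open>The size \<open>6 * (n * m) + 3\<close> is at most \<open>9 * (n * m)\<close>,
    so the exponent becomes at most \<open>n / 2\<close>; \<open>m\<close> depends on
    \<open>k\<close> only and is a constant here.\<close>
  define c :: real where "c = 1 / (18 * real m)"
  define pair where
    "pair n = (redundant_counter.inst k n, redundant_counter.state_tour k n (\<lambda>_. 0))" for n
  \<comment> \<open>From \<open>2 * (k + 1)\<close> on, \<open>n / 2\<close> is at most
    \<open>n - k - 1\<close>, the exponent of the iteration bound.\<close>
  define A where "A = pair ` {2 * (k + 1)..}"
  have m: "0 < m" by (simp add: m_def)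
  have counter: "redundant_counter n" if "2 * (k + 1) \<le> n" for n
    using that by unfold_locales simp
  have size: "card (verts (fst (pair n))) = 6 * (n * m) + 3" if "2 * (k + 1) \<le> n" for n
    using redundant_counter.card_verts_inst[OF counter[OF that]]
    by (simp add: pair_def m_def redundant_counter.m_def[OF counter[OF that]])
  have "0 < c" using m by (simp add: c_def)
  moreover have "A \<subseteq> Sigma (ls_instances (TSP_k_Opt k)) (ls_solutions (TSP_k_Opt k))"
    using redundant_counter.inst_is_instance[OF counter]
      redundant_counter.is_tour_inst_state_tour[OF counter redundant_counter.valid_zero[OF counter]]
    by (auto simp: A_def pair_def TSP_k_Opt_def)
  moreover have "infinite (ls_size (TSP_k_Opt k) ` fst ` A)"
  proof -
    have "ls_size (TSP_k_Opt k) ` fst ` A = (\<lambda>n. 6 * (n * m) + 3) ` {2 * (k + 1)..}"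
      unfolding A_def image_image using size by (intro image_cong) (auto simp: TSP_k_Opt_def)
    moreover have "inj (\<lambda>n. 6 * (n * m) + 3)" using m by (auto simp: inj_on_def)
    ultimately show ?thesis
      using finite_imageD infinite_Ici by (metis inj_on_subset subset_UNIV)
  qed
  moreover have "\<forall>(I, s) \<in> A. \<forall>p. pivot_rule (TSP_k_Opt k) I p \<longrightarrow>
      needs_iterations (TSP_k_Opt k) I p s (2 powr (c * real (ls_size (TSP_k_Opt k) I)))"
  proof -
    have "2 powr (c * real (card (verts (fst (pair n))))) \<le> 2 ^ (n - k - 1)" if n: "2 * (k + 1) \<le> n" for n
    proof -
      have "0 < n * m" using n m by simp
      then have "6 * (n * m) + 3 \<le> 9 * (n * m)" by linarith
      then have "real (6 * (n * m) + 3) \<le> real (9 * (n * m))" by (rule of_nat_mono)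
      then have "real (6 * (n * m) + 3) \<le> 9 * real n * real m" by simp
      then have "c * real (card (verts (fst (pair n)))) \<le> c * (9 * real n * real m)"
        using size[OF n] \<open>0 < c\<close> by simp
      also have "\<dots> = real n / 2" using m by (simp add: c_def)
      also have "\<dots> \<le> real (n - k - 1)" using n by (simp add: of_nat_diff)
      finally have "2 powr (c * real (card (verts (fst (pair n))))) \<le> 2 powr real (n - k - 1)" by simp
      then show ?thesis by (simp add: powr_realpow)
    qed
    then show ?thesis
      using redundant_counter.needs_iterations_state_tour[OF counter \<open>k \<ge> 5\<close>]
      by (auto simp: A_def pair_def TSP_k_Opt_def)
  qed
  ultimately show ?thesis unfolding all_exp_property_def by blast
qed

end
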